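(* Let $Y\in\mathbb{R}^{n\times p}$, $f(x)=\|Y^\top x\|_1$, and $\mathcal{M}=\{x\in\mathbb{R}^n:\|x\|_2=1\}$. Let $x\in\mathcal{M}$ and $d\in\mathbb{R}^n$ be such that $d^\top x=0$, and define $x^+=x+d$. Then, for any $z\in\mathcal{M}$ and any $s\in\partial f(x^+)$, $$f(z)-f(x^+)\ge\left\langle(I_n-xx^\top)s,\ z-x^+\right\rangle-\frac L2\|z-x\|_2^2.$$
   Context: $L$ denotes the Lipschitz constant of $f$, i.e., $|f(x)-f(y)|\le L\|x-y\|_2$ for all $x,y\in\mathbb{R}^n$. $\partial f$ is the usual convex subdifferential of $f$ on $\mathbb{R}^n$, and $I_n$ is the $n\times n$ identity matrix. *)

theory Defs
  imports "HOL-Analysis.Analysis"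
begin

definition l1_norm :: "real ^ 'p \<Rightarrow> real" where
  "l1_norm v = (\<Sum>i\<in>UNIV. \<bar>v $ i\<bar>)"

definition subdifferential :: "('a::real_inner \<Rightarrow> real) \<Rightarrow> 'a \<Rightarrow> 'a set" where
  "subdifferential f x = {s. \<forall>y. f y \<ge> f x + s \<bullet> (y - x)}"

(* The matrix x x^T: the product of the (n x 1)-matrix x with the (1 x n)-matrix x^T.
   The type annotations fix the inner dimension to 1, which the library leaves polymorphic. *)
definition outer_square :: "real ^ 'n \<Rightarrow> real ^ 'n ^ 'n" where
  "outer_square x = (columnvector x :: real ^ 1 ^ 'n) ** (rowvector x :: real ^ 'n ^ 1)"

end

theory Submission
  imports Defs
begin

text \<open>Start from the subgradient inequality at \<open>xp\<close> and split off the component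
  of \<open>s\<close> along \<open>x\<close>. Replacing \<open>s\<close> by its tangential
  projection changes the linear term by \<open>(s \<bullet> x) * (x \<bullet> (z - xp))\<close>. On
  the sphere the second factor is only quadratic in \<open>z - x\<close>, and the first is at most
  \<open>L\<close> by \<open>subgradient_inner_le_lipschitz\<close>, which yields the error
  term.\<close>

lemma outer_square_mult_vector: "outer_square x *v s = (x \<bullet> s) *\<^sub>R x"
  by (simp add: vec_eq_iff outer_square_def matrix_vector_mult_def matrix_matrix_mult_def
      columnvector_def rowvector_def inner_vec_def sum_distrib_left sum_distrib_right mult_ac)

text \<open>The subgradient inequality at \<open>x + v\<close> bounds \<open>s \<bullet> v\<close>
  by the increment of \<open>f\<close>, which the Lipschitz condition controls.\<close>

lemma subgradient_inner_le_lipschitz: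
  assumes L: "lipschitz_on L UNIV f" and s: "s \<in> subdifferential f x"
  shows "s \<bullet> v \<le> L * norm v"
proof -
  have "f x + s \<bullet> v \<le> f (x + v)"
    using s[unfolded subdifferential_def, simplified, rule_format, of "x + v"] by simp
  moreover have "dist (f (x + v)) (f x) \<le> L * dist (x + v) x"
    using L by (rule lipschitz_onD) auto
  ultimately show ?thesis
    by (simp add: dist_norm)
qed

theorem propositionC1:
  fixes Y :: "real ^ 'p ^ 'n"
    and f :: "real ^ 'n \<Rightarrow> real"
    and L :: real
    and x d xp z s :: "real ^ 'n"
  assumes f: "f = (\<lambda>u. l1_norm (transpose Y *v u))"
    and L: "lipschitz_on L UNIV f"
    and x: "x \<in> sphere 0 1"
    and d: "d \<bullet> x = 0"
    and xp: "xp = x + d"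
    and z: "z \<in> sphere 0 1"
    and s: "s \<in> subdifferential f xp"
  shows "f z - f xp \<ge> ((mat 1 - outer_square x) *v s) \<bullet> (z - xp) - L / 2 * (norm (z - x))\<^sup>2"
proof -
  have unit: "x \<bullet> x = 1" "z \<bullet> z = 1"
    using x z by (simp_all add: dot_square_norm)
  \<comment> \<open>As \<open>d\<close> is orthogonal to \<open>x\<close>, the left side is
    \<open>x \<bullet> z - 1\<close>; for unit vectors the squared distance is
    \<open>2 - 2 * (x \<bullet> z)\<close>.\<close>
  have normal: "x \<bullet> (z - xp) = - ((norm (z - x))\<^sup>2 / 2)"
    using unit d by (simp add: xp power2_norm_eq_inner inner_diff inner_add_right inner_commute field_simps)
  \<comment> \<open>The direction tested at \<open>xp\<close> is the unit vector \<open>x\<close>. A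
    one-sided bound suffices, since it multiplies a square.\<close>
  have "s \<bullet> x \<le> L"
    using subgradient_inner_le_lipschitz[OF L s, of x] x by simp
  then have "L * (norm (z - x))\<^sup>2 \<ge> (s \<bullet> x) * (norm (z - x))\<^sup>2"
    by (rule mult_right_mono) simp
  moreover have "((mat 1 - outer_square x) *v s) \<bullet> (z - xp)
      = s \<bullet> (z - xp) + (s \<bullet> x) * ((norm (z - x))\<^sup>2 / 2)"
    by (simp add: matrix_vector_mult_diff_rdistrib outer_square_mult_vector inner_diff_left normal
        inner_commute[of x s])
  moreover have "f z \<ge> f xp + s \<bullet> (z - xp)"
    using s by (simp add: subdifferential_def)
  ultimately show ?thesis
    by simp
qed

end
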